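(* Assume that $A^a=\sqrt{\phi^a\kappa}$ for all $a$ and that the $(A^a)$ are bounded. Let $\alpha_0>0$ be such that for $|\alpha|\le\alpha_0$ there is a unique $\mu\in C([0,T])$ with, for all $t\in[0,T]$, $$ \begin{aligned} \mu(t)=&-\int_a\theta^a\exp\{-\theta^at\}E_0^a\,\bar m_0(da)+\frac{\alpha}{2\kappa}\int_t^T\mu(s)\int_a\exp\{\theta^a(t-s)\}\,\bar m_0(da)\,ds\\ &-\frac{\alpha}{2\kappa}\int_0^t\int_\tau^T\mu(s)\int_a\theta^a\exp\{\theta^a(2\tau-t-s)\}\,\bar m_0(da)\,ds\,d\tau , \end{aligned} $$ and let $\mu$ denote this solution (the net trading flow of the mean field game crowd trading model). Let $(\mu^{a,n})$ be the sequence of estimates produced by the learning procedure defined in the context. Assume that $$ \frac{1}{Cn}\le\pi^{a,n}\le\frac{C}{n} $$ for some constant $C$. Suppose also that $\alpha$ is small enough: $|\alpha|\le\alpha_1$ for some small $\alpha_1>0$ depending on $C$ (with $\alpha_1\le\alpha_0$, so that $\mu$ is well defined). Then $$ \limsup_{n\to\infty}\ \sup_a\left\|\mu^{a,n}-\mu\right\|_\infty\le C'\varepsilon $$ for some constant $C'$.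
   Context: $T>0$ is a fixed horizon and $\kappa>0$ is the temporary market impact coefficient. A continuum of agents is indexed by a parameter $a$; agent $a$ has risk aversion parameters $\phi^a$ and $A^a$. The probability measure $m_0(da,dq)$ is the initial joint distribution of $a$ and of the inventory $q\in\mathbb{R}$; $\bar m_0(da)=\int_q m_0(da,dq)$, $m_0(da,dq)=m_0^a(dq)\,\bar m_0(da)$, and $E_0^a=\int_q q\,m_0^a(dq)$. Set $\theta^a=A^a/\kappa$. $\alpha\in\mathbb{R}$ is the permanent market impact coefficient, and $\|\cdot\|_\infty$ is the sup norm on $[0,T]$. Learning procedure. The game on $[0,T]$ is repeated over rounds indexed by $n$. At the beginning of round $n$ each agent $a$ has an estimate $\mu^{a,n}$ (a function of $t\in[0,T]$) of the net trading flow, and he plays optimally against this estimate. The resulting net trading flow of all agents is $$ \begin{aligned} m^{n+1}(t):=&-\int_a\theta^a\exp\{-\theta^at\}E_0^a\,\bar m_0(da)+\frac{\alpha}{2\kappa}\int_t^T\int_a\mu^{a,n}(s)\exp\{\theta^a(t-s)\}\,\bar m_0(da)\,ds\\ &-\frac{\alpha}{2\kappa}\int_0^t\int_\tau^T\int_a\mu^{a,n}(s)\,\theta^a\exp\{\theta^a(2\tau-t-s)\}\,\bar m_0(da)\,ds\,d\tau . \end{aligned} $$ Each agent then updates his estimate by $$ \mu^{a,n+1}(t):=(1-\pi^{a,n+1})\mu^{a,n}(t)+\pi^{a,n+1}\left(m^{n+1}(t)+\varepsilon^{a,n+1}(t)\right), $$ where $\pi^{a,n+1}\in(0,1)$ is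 the weight chosen by agent $a$ at round $n+1$ and $\varepsilon^{a,n+1}$ is a small measurement error with $\|\varepsilon^{a,n+1}\|_\infty\le\varepsilon$.
   Formalization: The initial estimates are assumed uniformly bounded over all agents a and times t; without this the supremum over a can be infinite in every round (e.g. for zero impact α), so the claim fails as literally stated. *)

theory Defs
  imports "HOL-Probability.Probability"
begin

definition sup_norm :: "real \<Rightarrow> (real \<Rightarrow> real) \<Rightarrow> ereal" where
  "sup_norm T f = (SUP t\<in>{0..T}. ereal \<bar>f t\<bar>)"

text \<open>
  \<open>k\<close> is a regular version of the conditional law of the inventory given the agent, i.e.
  \<open>m0(da,dq) = k a (dq) mbar(da)\<close> where \<open>mbar\<close> is the marginal of \<open>m0\<close> on the measurable
  space \<open>M\<close> of agents. Only the measurable structure of \<open>M\<close> is used.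
\<close>

definition disintegrates ::
  "'a measure \<Rightarrow> ('a \<times> real) measure \<Rightarrow> 'a measure \<Rightarrow> ('a \<Rightarrow> real measure) \<Rightarrow> bool" where
  "disintegrates M m0 mbar k \<longleftrightarrow>
     prob_space m0 \<and> sets m0 = sets (M \<Otimes>\<^sub>M borel) \<and>
     mbar = distr m0 M fst \<and>
     k \<in> M \<rightarrow>\<^sub>M prob_algebra borel \<and>
     (\<forall>B\<in>sets (M \<Otimes>\<^sub>M borel). emeasure m0 B = (\<integral>\<^sup>+ a. emeasure (k a) (Pair a -` B) \<partial>mbar))"

text \<open>
  The net trading flow that results when agent \<open>a\<close> plays optimally against the estimate \<open>\<nu> a\<close>.
  All integrals are Lebesgue integrals.
\<close>

definition resulting_flow ::
  "real \<Rightarrow> real \<Rightarrow> 'a measure \<Rightarrow> ('a \<Rightarrow> real) \<Rightarrow> ('a \<Rightarrow> real) \<Rightarrow> real \<Rightarrow>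
   ('a \<Rightarrow> real \<Rightarrow> real) \<Rightarrow> real \<Rightarrow> real" where
  "resulting_flow T \<kappa> mbar \<theta> E0 \<alpha> \<nu> t =
     - (LINT a|mbar. \<theta> a * exp (- \<theta> a * t) * E0 a)
     + \<alpha> / (2 * \<kappa>) *
         (LINT s:{t..T}|lborel. (LINT a|mbar. \<nu> a s * exp (\<theta> a * (t - s))))
     - \<alpha> / (2 * \<kappa>) *
         (LINT \<tau>:{0..t}|lborel. (LINT s:{\<tau>..T}|lborel.
            (LINT a|mbar. \<nu> a s * \<theta> a * exp (\<theta> a * (2 * \<tau> - t - s)))))"

definition equilibrium_flow ::
  "real \<Rightarrow> real \<Rightarrow> 'a measure \<Rightarrow> ('a \<Rightarrow> real) \<Rightarrow> ('a \<Rightarrow> real) \<Rightarrow> real \<Rightarrow>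
   (real \<Rightarrow> real) \<Rightarrow> bool" where
  "equilibrium_flow T \<kappa> mbar \<theta> E0 \<alpha> \<mu> \<longleftrightarrow>
     continuous_on {0..T} \<mu> \<and>
     (\<forall>t\<in>{0..T}. \<mu> t =
       - (LINT a|mbar. \<theta> a * exp (- \<theta> a * t) * E0 a)
       + \<alpha> / (2 * \<kappa>) *
           (LINT s:{t..T}|lborel. \<mu> s * (LINT a|mbar. exp (\<theta> a * (t - s))))
       - \<alpha> / (2 * \<kappa>) *
           (LINT \<tau>:{0..t}|lborel. (LINT s:{\<tau>..T}|lborel.
              \<mu> s * (LINT a|mbar. \<theta> a * exp (\<theta> a * (2 * \<tau> - t - s))))))"

text \<open>
  \<open>est a n\<close> is the estimate of agent \<open>a\<close> at the beginning of round \<open>n\<close>, with rounds starting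
  at \<open>0\<close>; the weights \<open>w a n\<close> and errors \<open>err a n\<close> are relevant for \<open>n \<ge> 1\<close> only.
  Joint measurability of the data gives a meaning to the integrals over the agents. The initial
  estimates have to be uniformly bounded: otherwise \<open>SUP a. sup_norm T (est a n - \<mu>)\<close>
  can be infinite for every \<open>n\<close>.
\<close>

definition learning_procedure ::
  "real \<Rightarrow> real \<Rightarrow> 'a measure \<Rightarrow> ('a \<Rightarrow> real) \<Rightarrow> ('a \<Rightarrow> real) \<Rightarrow> real \<Rightarrow> real \<Rightarrow>
   ('a \<Rightarrow> nat \<Rightarrow> real) \<Rightarrow> ('a \<Rightarrow> nat \<Rightarrow> real \<Rightarrow> real) \<Rightarrow> ('a \<Rightarrow> nat \<Rightarrow> real \<Rightarrow> real) \<Rightarrow> bool" where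
  "learning_procedure T \<kappa> mbar \<theta> E0 \<alpha> \<epsilon> w err est \<longleftrightarrow>
     (\<lambda>(a, t). est a 0 t) \<in> borel_measurable (mbar \<Otimes>\<^sub>M restrict_space borel {0..T}) \<and>
     (SUP a\<in>space mbar. sup_norm T (est a 0)) < \<infinity> \<and>
     (\<forall>n\<ge>1. (\<lambda>a. w a n) \<in> borel_measurable mbar \<and>
        (\<lambda>(a, t). err a n t) \<in> borel_measurable (mbar \<Otimes>\<^sub>M restrict_space borel {0..T})) \<and>
     (\<forall>a\<in>space mbar. \<forall>n\<ge>1. 0 < w a n \<and> w a n < 1 \<and> sup_norm T (err a n) \<le> ereal \<epsilon>) \<and>
     (\<forall>a\<in>space mbar. \<forall>n. \<forall>t\<in>{0..T}.
        est a (Suc n) t =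
          (1 - w a (Suc n)) * est a n t
          + w a (Suc n) *
              (resulting_flow T \<kappa> mbar \<theta> E0 \<alpha> (\<lambda>b. est b n) t + err a (Suc n) t))"

end

theory Submission
  imports Defs
begin

text \<open>
  The map from estimates to the resulting flow is affine, and the equilibrium flow \<open>\<mu>\<close> is its
  fixed point. Since \<open>0 \<le> \<theta> \<le> B\<close> and all exponents are nonpositive, its linear part has sup norm
  at most \<open>\<bar>\<alpha>\<bar> L\<close> with \<open>L = T (1 + T B) / (2 \<kappa>)\<close>. If \<open>\<bar>\<alpha>\<bar> L \<le> 1/2\<close> and \<open>r\<close> bounds the
  distance of all estimates to \<open>\<mu>\<close>, an update of weight \<open>v\<close> yields the bound
  \<open>(1 - v) r + v (r/2 + \<epsilon>)\<close>, that is, it multiplies \<open>r - 2 \<epsilon>\<close> by \<open>1 - v/2 \<le> 1 - 1 / (2 C n)\<close>.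
  The product of these factors tends to zero because the harmonic series diverges.
\<close>

section \<open>Bounds on compact intervals\<close>

lemma set_integral_interval_bounded:
  fixes f :: "real \<Rightarrow> real"
  assumes "f \<in> borel_measurable borel" "\<And>s. s \<in> {l..r} \<Longrightarrow> \<bar>f s\<bar> \<le> D" "l \<le> r"
  shows "set_integrable lborel {l..r} f" "\<bar>LINT s:{l..r}|lborel. f s\<bar> \<le> (r - l) * D"
proof -
  have c: "set_integrable lborel {l..r} (\<lambda>s. D)"
    using assms(3) by (simp add: set_integrable_def integrable_indicator_iff)
  show f: "set_integrable lborel {l..r} f"
    unfolding set_integrable_def
  proof (rule Bochner_Integration.integrable_bound[OF c[unfolded set_integrable_def]])
    show "AE x in lborel. norm (indicat_real {l..r} x *\<^sub>R f x) \<le> norm (indicat_real {l..r} x *\<^sub>R D)"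
      using assms(2) by (intro AE_I2) (fastforce simp: indicator_def)
  qed (use assms(1) in measurable)
  have "\<bar>LINT s:{l..r}|lborel. f s\<bar> \<le> (LINT s:{l..r}|lborel. \<bar>f s\<bar>)"
    using set_integral_norm_bound[OF f] by simp
  also have "\<dots> \<le> (LINT s:{l..r}|lborel. D)"
    using assms(2) by (intro set_integral_mono set_integrable_abs f c)
  also have "\<dots> = (r - l) * D"
    using assms(3) by (simp add: set_lebesgue_integral_def)
  finally show "\<bar>LINT s:{l..r}|lborel. f s\<bar> \<le> (r - l) * D" .
qed

lemma continuous_on_Icc_bounded:
  fixes f :: "real \<Rightarrow> real"
  assumes "continuous_on {l..r} f"
  obtains U where "\<And>t. t \<in> {l..r} \<Longrightarrow> \<bar>f t\<bar> \<le> U"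
proof -
  have "bounded (f ` {l..r})"
    by (intro compact_imp_bounded compact_continuous_image assms) simp
  then obtain U where "\<forall>y\<in>f ` {l..r}. norm y \<le> U"
    unfolding bounded_iff by blast
  then show thesis by (intro that[of U]) auto
qed

section \<open>The part of the flow that is linear in the estimates\<close>

text \<open>The remaining term, the one with \<open>E0\<close>, is common to the resulting flow and
  to the equilibrium equation. It cancels in their difference, so this part is all that has to be
  estimated.\<close>

definition impact :: "real \<Rightarrow> 'a measure \<Rightarrow> ('a \<Rightarrow> real) \<Rightarrow> ('a \<Rightarrow> real \<Rightarrow> real) \<Rightarrow> real \<Rightarrow> real" where
  "impact T mbar \<theta> \<nu> t =
     (LINT s:{t..T}|lborel. (LINT a|mbar. \<nu> a s * exp (\<theta> a * (t - s))))
     - (LINT \<tau>:{0..t}|lborel. (LINT s:{\<tau>..T}|lborel.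
          (LINT a|mbar. \<nu> a s * \<theta> a * exp (\<theta> a * (2 * \<tau> - t - s)))))"

lemma resulting_flow_impact:
  "resulting_flow T \<kappa> mbar \<theta> E0 \<alpha> \<nu> t =
     - (LINT a|mbar. \<theta> a * exp (- \<theta> a * t) * E0 a) + \<alpha> / (2 * \<kappa>) * impact T mbar \<theta> \<nu> t"
  by (simp add: resulting_flow_def impact_def algebra_simps)

text \<open>In the equilibrium equation \<open>\<mu> s\<close> stands outside the integral over the
  agents. When all agents share the estimate \<mu> it can be moved inside, which exhibits \<mu> as a
  fixed point of the flow map.\<close>

lemma equilibrium_flow_impact:
  assumes "equilibrium_flow T \<kappa> mbar \<theta> E0 \<alpha> \<mu>" "t \<in> {0..T}"
  shows "\<mu> t = - (LINT a|mbar. \<theta> a * exp (- \<theta> a * t) * E0 a)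
            + \<alpha> / (2 * \<kappa>) * impact T mbar \<theta> (\<lambda>_. \<mu>) t"
  using assms by (simp add: equilibrium_flow_def impact_def right_diff_distrib mult.assoc)

text \<open>For t in [0,T] every integration time lies in [0,T]. This allows an estimate to be
  exchanged for a version that is well behaved on the whole line.\<close>

lemma impact_cong:
  assumes "\<And>a s. a \<in> space mbar \<Longrightarrow> s \<in> {0..T} \<Longrightarrow> \<nu> a s = \<nu>' a s" "t \<in> {0..T}"
  shows "impact T mbar \<theta> \<nu> t = impact T mbar \<theta> \<nu>' t"
  unfolding impact_def using assms
  by (intro arg_cong2[where f = "(-)"] set_lebesgue_integral_cong allI impI
       Bochner_Integration.integral_cong refl) auto

section \<open>Products with harmonic factors\<close>

text \<open>Since 1 - x \<le> exp (- x), the product is at most exp (- H_n / c) with H_n the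
  harmonic number. The second hypothesis makes the factors nonnegative, as the lower bound and the
  factorwise comparison require.\<close>

lemma prod_one_minus_harmonic_tendsto_0:
  fixes c :: real
  assumes "c > 0" "\<And>i. i \<ge> 1 \<Longrightarrow> 1 / (c * real i) \<le> 1"
  shows "(\<lambda>n. \<Prod>i=1..n. 1 - 1 / (c * real i)) \<longlonglongrightarrow> 0"
proof (rule tendsto_sandwich)
  show "\<forall>\<^sub>F n in sequentially. 0 \<le> (\<Prod>i=1..n. 1 - 1 / (c * real i))"
    using assms(2) by (intro always_eventually allI prod_nonneg) auto
  have "(\<Prod>i=1..n. 1 - 1 / (c * real i)) \<le> exp (- (harm n / c))" for n
  proof -
    have "(\<Prod>i=1..n. 1 - 1 / (c * real i)) \<le> (\<Prod>i=1..n. exp (- 1 / (c * real i)))"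
      using assms(2) exp_ge_add_one_self[of "- 1 / (c * real i)" for i]
      by (intro prod_mono conjI) auto
    also have "\<dots> = exp (\<Sum>i=1..n. - 1 / (c * real i))"
      by (simp add: exp_sum)
    also have "(\<Sum>i=1..n. - 1 / (c * real i)) = - (harm n / c)"
      by (simp add: harm_def sum_divide_distrib sum_negf field_simps)
    finally show ?thesis .
  qed
  then show "\<forall>\<^sub>F n in sequentially. (\<Prod>i=1..n. 1 - 1 / (c * real i)) \<le> exp (- (harm n / c))"
    by simp
  have "filterlim (\<lambda>n. harm n / c) at_top sequentially"
    using assms(1) harm_at_top
    by (simp add: filterlim_at_top_mult_tendsto_pos divide_inverse mult.commute
      filterlim_tendsto_pos_mult_at_top[OF tendsto_const])
  then show "(\<lambda>n. exp (- (harm n / c))) \<longlonglongrightarrow> 0"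
    by (intro filterlim_compose[OF exp_at_bot]) (simp add: filterlim_uminus_at_bot)
qed simp

section \<open>Measurability, integrability and size of the impact\<close>

locale bounded_agents = prob_space mbar for mbar :: "'a measure" +
  fixes T B :: real and \<theta> :: "'a \<Rightarrow> real"
  assumes T_pos: "T > 0"
    and \<theta>_meas[measurable]: "\<theta> \<in> borel_measurable mbar"
    and \<theta>_nonneg: "a \<in> space mbar \<Longrightarrow> 0 \<le> \<theta> a"
    and \<theta>_le: "a \<in> space mbar \<Longrightarrow> \<theta> a \<le> B"
begin

lemma measurable_impact:
  assumes [measurable]: "(\<lambda>(a, s). \<nu> a s) \<in> borel_measurable (mbar \<Otimes>\<^sub>M borel)"
  shows "impact T mbar \<theta> \<nu> \<in> borel_measurable borel"
proof -
  \<comment> \<open>The endpoints of integration move with the parameter, so the indicators must be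
    jointly measurable before the parametrised integrals are.\<close>
  have [measurable]: "(\<lambda>(t, s). indicat_real {t..T} s) \<in> borel_measurable (borel \<Otimes>\<^sub>M borel)"
    unfolding indicator_def of_bool_def atLeastAtMost_iff case_prod_beta by measurable
  have [measurable]: "(\<lambda>(t, s). indicat_real {0..t::real} s) \<in> borel_measurable (borel \<Otimes>\<^sub>M borel)"
    unfolding indicator_def of_bool_def atLeastAtMost_iff case_prod_beta by measurable
  show ?thesis
    unfolding impact_def set_lebesgue_integral_def by measurable
qed

lemma B_nonneg: "0 \<le> B"
  using \<theta>_nonneg \<theta>_le not_empty by (metis all_not_in_conv order_trans)

lemma integral_agents_bounded:
  fixes f :: "'a \<Rightarrow> real"
  assumes [measurable]: "f \<in> borel_measurable mbar" and "\<And>a. a \<in> space mbar \<Longrightarrow> \<bar>f a\<bar> \<le> D"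
  shows "integrable mbar f" "\<bar>LINT a|mbar. f a\<bar> \<le> D"
proof -
  show f: "integrable mbar f"
    using assms(2) by (intro integrable_const_bound[where B = D]) auto
  have "\<bar>LINT a|mbar. f a\<bar> \<le> (LINT a|mbar. \<bar>f a\<bar>)"
    by (rule integral_abs_bound)
  also have "\<dots> \<le> D"
    using assms(2) f by (intro integral_le_const) auto
  finally show "\<bar>LINT a|mbar. f a\<bar> \<le> D" .
qed

context
  fixes \<nu> :: "'a \<Rightarrow> real \<Rightarrow> real" and D :: real
  assumes \<nu>_meas[measurable]: "(\<lambda>(a, s). \<nu> a s) \<in> borel_measurable (mbar \<Otimes>\<^sub>M borel)"
    and \<nu>_bound: "\<forall>a\<in>space mbar. \<forall>s\<in>{0..T}. \<bar>\<nu> a s\<bar> \<le> D"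
begin

text \<open>Here \<open>x\<close> stands for t - s with t \<le> s, or for 2 \<tau> - t - s with
  \<tau> \<le> t and \<tau> \<le> s. Both are nonpositive, so nonnegative rates keep the
  exponentials at most 1.\<close>

lemma impact_kernel_bounds:
  assumes "a \<in> space mbar" "s \<in> {0..T}" "x \<le> 0"
  shows "\<bar>\<nu> a s * exp (\<theta> a * x)\<bar> \<le> D" "\<bar>\<nu> a s * \<theta> a * exp (\<theta> a * x)\<bar> \<le> D * B"
proof -
  have e: "exp (\<theta> a * x) \<le> 1"
    using \<theta>_nonneg[OF assms(1)] assms(3) by (simp add: mult_nonneg_nonpos)
  have "\<bar>\<nu> a s\<bar> * exp (\<theta> a * x) \<le> D * 1"
    using bspec[OF bspec[OF \<nu>_bound assms(1)] assms(2)] e by (intro mult_mono) auto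
  then show "\<bar>\<nu> a s * exp (\<theta> a * x)\<bar> \<le> D" by (simp add: abs_mult)
  have "\<bar>\<nu> a s\<bar> * \<theta> a * exp (\<theta> a * x) \<le> D * B * 1"
    using bspec[OF bspec[OF \<nu>_bound assms(1)] assms(2)] e \<theta>_nonneg[OF assms(1)] \<theta>_le[OF assms(1)] B_nonneg
    by (intro mult_mono) auto
  then show "\<bar>\<nu> a s * \<theta> a * exp (\<theta> a * x)\<bar> \<le> D * B"
    using \<theta>_nonneg[OF assms(1)] by (simp add: abs_mult)
qed

text \<open>Integrability is recorded at each level of integration because the linearity of
  \<open>impact\<close> depends on it; the bound feeds \<open>impact_bound\<close>.\<close>

lemma impact_first_term:
  assumes "t \<in> {0..T}"
  shows "s \<in> {t..T} \<Longrightarrow> integrable mbar (\<lambda>a. \<nu> a s * exp (\<theta> a * (t - s)))"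
    and "set_integrable lborel {t..T} (\<lambda>s. LINT a|mbar. \<nu> a s * exp (\<theta> a * (t - s)))"
    and "\<bar>LINT s:{t..T}|lborel. LINT a|mbar. \<nu> a s * exp (\<theta> a * (t - s))\<bar> \<le> (T - t) * D"
proof -
  let ?g = "\<lambda>s. LINT a|mbar. \<nu> a s * exp (\<theta> a * (t - s))"
  have b: "\<bar>\<nu> a s * exp (\<theta> a * (t - s))\<bar> \<le> D" if "s \<in> {t..T}" "a \<in> space mbar" for s a
    using that assms by (intro impact_kernel_bounds) auto
  show "integrable mbar (\<lambda>a. \<nu> a s * exp (\<theta> a * (t - s)))" if "s \<in> {t..T}" for s
    using b[OF that] by (intro integral_agents_bounded(1)[where D = D]) measurable
  have g: "\<bar>?g s\<bar> \<le> D" if "s \<in> {t..T}" for s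
    using b[OF that] by (intro integral_agents_bounded(2)) measurable
  have m: "?g \<in> borel_measurable borel" by measurable
  show "set_integrable lborel {t..T} ?g" "\<bar>LINT s:{t..T}|lborel. ?g s\<bar> \<le> (T - t) * D"
    using set_integral_interval_bounded[OF m g] assms by auto
qed

lemma impact_second_term:
  assumes "t \<in> {0..T}"
  shows "\<tau> \<in> {0..t} \<Longrightarrow> s \<in> {\<tau>..T} \<Longrightarrow>
           integrable mbar (\<lambda>a. \<nu> a s * \<theta> a * exp (\<theta> a * (2 * \<tau> - t - s)))"
    and "\<tau> \<in> {0..t} \<Longrightarrow> set_integrable lborel {\<tau>..T}
           (\<lambda>s. LINT a|mbar. \<nu> a s * \<theta> a * exp (\<theta> a * (2 * \<tau> - t - s)))"
    and "set_integrable lborel {0..t} (\<lambda>\<tau>. LINT s:{\<tau>..T}|lborel.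
           LINT a|mbar. \<nu> a s * \<theta> a * exp (\<theta> a * (2 * \<tau> - t - s)))"
    and "\<bar>LINT \<tau>:{0..t}|lborel. LINT s:{\<tau>..T}|lborel.
           LINT a|mbar. \<nu> a s * \<theta> a * exp (\<theta> a * (2 * \<tau> - t - s))\<bar> \<le> (t - 0) * (T * (D * B))"
proof -
  let ?h = "\<lambda>\<tau> s. LINT a|mbar. \<nu> a s * \<theta> a * exp (\<theta> a * (2 * \<tau> - t - s))"
  have b: "\<bar>\<nu> a s * \<theta> a * exp (\<theta> a * (2 * \<tau> - t - s))\<bar> \<le> D * B"
    if "\<tau> \<in> {0..t}" "s \<in> {\<tau>..T}" "a \<in> space mbar" for \<tau> s a
    using that assms by (intro impact_kernel_bounds) auto
  show "integrable mbar (\<lambda>a. \<nu> a s * \<theta> a * exp (\<theta> a * (2 * \<tau> - t - s)))"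
    if "\<tau> \<in> {0..t}" "s \<in> {\<tau>..T}" for \<tau> s
    using b[OF that] by (intro integral_agents_bounded(1)[where D = "D * B"]) measurable
  have h: "\<bar>?h \<tau> s\<bar> \<le> D * B" if "\<tau> \<in> {0..t}" "s \<in> {\<tau>..T}" for \<tau> s
    using b[OF that] by (intro integral_agents_bounded(2)) measurable
  \<comment> \<open>An absolute value lies below \<open>D * B\<close>; the point \<tau> = s = 0 is
    always admissible.\<close>
  have DB: "0 \<le> D * B"
    using h[of 0 0] assms by simp
  show "set_integrable lborel {\<tau>..T} (?h \<tau>)" if "\<tau> \<in> {0..t}" for \<tau>
    using h that assms by (intro set_integral_interval_bounded(1)[where D = "D * B"]) auto
  have [measurable]: "(\<lambda>(\<tau>, s). indicat_real {\<tau>..T} s) \<in> borel_measurable (borel \<Otimes>\<^sub>M borel)"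
    unfolding indicator_def of_bool_def atLeastAtMost_iff case_prod_beta by measurable
  have m: "(\<lambda>\<tau>. LINT s:{\<tau>..T}|lborel. ?h \<tau> s) \<in> borel_measurable borel"
    unfolding set_lebesgue_integral_def by measurable
  have i: "\<bar>LINT s:{\<tau>..T}|lborel. ?h \<tau> s\<bar> \<le> T * (D * B)" if "\<tau> \<in> {0..t}" for \<tau>
  proof -
    have "\<bar>LINT s:{\<tau>..T}|lborel. ?h \<tau> s\<bar> \<le> (T - \<tau>) * (D * B)"
      using h that assms by (intro set_integral_interval_bounded(2)) auto
    also have "\<dots> \<le> T * (D * B)"
      using that DB by (intro mult_right_mono) auto
    finally show ?thesis .
  qed
  show "set_integrable lborel {0..t} (\<lambda>\<tau>. LINT s:{\<tau>..T}|lborel. ?h \<tau> s)"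
    "\<bar>LINT \<tau>:{0..t}|lborel. LINT s:{\<tau>..T}|lborel. ?h \<tau> s\<bar> \<le> (t - 0) * (T * (D * B))"
    using set_integral_interval_bounded[OF m i, of 0 t] assms by auto
qed

text \<open>The single integral contributes at most T D and the double integral at most T (T D
  B).\<close>

lemma impact_bound:
  assumes "t \<in> {0..T}"
  shows "\<bar>impact T mbar \<theta> \<nu> t\<bar> \<le> T * (1 + T * B) * D"
proof -
  obtain a where a: "a \<in> space mbar" using not_empty by auto
  have D: "0 \<le> D" using \<nu>_bound a assms by fastforce
  have "\<bar>impact T mbar \<theta> \<nu> t\<bar> \<le> (T - t) * D + (t - 0) * (T * (D * B))"
    unfolding impact_def using impact_first_term(3)[OF assms] impact_second_term(4)[OF assms] by linarith
  also have "\<dots> \<le> T * D + T * (T * (D * B))"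
    using assms T_pos D B_nonneg by (intro add_mono mult_right_mono) auto
  finally show ?thesis by (simp add: algebra_simps)
qed

end

section \<open>Linearity, and distance of the flow to equilibrium\<close>

text \<open>The integrals are split from the inside out: over the agents, then over s, then over
  \<tau>. Boundedness of both estimates supplies the integrability needed at each level.\<close>

lemma impact_diff:
  assumes \<nu>: "(\<lambda>(a, s). \<nu> a s) \<in> borel_measurable (mbar \<Otimes>\<^sub>M borel)"
      "\<forall>a\<in>space mbar. \<forall>s\<in>{0..T}. \<bar>\<nu> a s\<bar> \<le> D"
    and \<nu>': "(\<lambda>(a, s). \<nu>' a s) \<in> borel_measurable (mbar \<Otimes>\<^sub>M borel)"
      "\<forall>a\<in>space mbar. \<forall>s\<in>{0..T}. \<bar>\<nu>' a s\<bar> \<le> D'"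
    and t: "t \<in> {0..T}"
  shows "impact T mbar \<theta> (\<lambda>a s. \<nu> a s - \<nu>' a s) t = impact T mbar \<theta> \<nu> t - impact T mbar \<theta> \<nu>' t"
proof -
  note t1 = impact_first_term[OF \<nu> t] and t1' = impact_first_term[OF \<nu>' t]
  note t2 = impact_second_term[OF \<nu> t] and t2' = impact_second_term[OF \<nu>' t]
  have "(LINT s:{t..T}|lborel. LINT a|mbar. (\<nu> a s - \<nu>' a s) * exp (\<theta> a * (t - s))) =
      (LINT s:{t..T}|lborel. (LINT a|mbar. \<nu> a s * exp (\<theta> a * (t - s)))
        - (LINT a|mbar. \<nu>' a s * exp (\<theta> a * (t - s))))"
    using t1(1) t1'(1) by (intro set_lebesgue_integral_cong) (auto simp: left_diff_distrib)
  moreover have "(LINT \<tau>:{0..t}|lborel. LINT s:{\<tau>..T}|lborel.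
        LINT a|mbar. (\<nu> a s - \<nu>' a s) * \<theta> a * exp (\<theta> a * (2 * \<tau> - t - s))) =
      (LINT \<tau>:{0..t}|lborel. (LINT s:{\<tau>..T}|lborel.
        LINT a|mbar. \<nu> a s * \<theta> a * exp (\<theta> a * (2 * \<tau> - t - s))) - (LINT s:{\<tau>..T}|lborel.
        LINT a|mbar. \<nu>' a s * \<theta> a * exp (\<theta> a * (2 * \<tau> - t - s))))"
  proof (intro set_lebesgue_integral_cong allI impI)
    fix \<tau> assume \<tau>: "\<tau> \<in> {0..t}"
    have "(LINT s:{\<tau>..T}|lborel. LINT a|mbar. (\<nu> a s - \<nu>' a s) * \<theta> a * exp (\<theta> a * (2 * \<tau> - t - s)))
      = (LINT s:{\<tau>..T}|lborel. (LINT a|mbar. \<nu> a s * \<theta> a * exp (\<theta> a * (2 * \<tau> - t - s)))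
          - (LINT a|mbar. \<nu>' a s * \<theta> a * exp (\<theta> a * (2 * \<tau> - t - s))))"
      using t2(1)[OF \<tau>] t2'(1)[OF \<tau>]
      by (intro set_lebesgue_integral_cong) (auto simp: left_diff_distrib)
    then show "(LINT s:{\<tau>..T}|lborel. LINT a|mbar. (\<nu> a s - \<nu>' a s) * \<theta> a * exp (\<theta> a * (2 * \<tau> - t - s)))
      = (LINT s:{\<tau>..T}|lborel. LINT a|mbar. \<nu> a s * \<theta> a * exp (\<theta> a * (2 * \<tau> - t - s)))
        - (LINT s:{\<tau>..T}|lborel. LINT a|mbar. \<nu>' a s * \<theta> a * exp (\<theta> a * (2 * \<tau> - t - s)))"
      using t2(2)[OF \<tau>] t2'(2)[OF \<tau>] by simp
  qed simp
  ultimately show ?thesis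
    unfolding impact_def using t1(2) t1'(2) t2(3) t2'(3) by simp
qed

lemma measurable_clamp:
  assumes [measurable]: "(\<lambda>(a, t). \<nu> a t) \<in> borel_measurable (mbar \<Otimes>\<^sub>M restrict_space borel {0..T})"
  shows "(\<lambda>(a, t). \<nu> a (max 0 (min T t))) \<in> borel_measurable (mbar \<Otimes>\<^sub>M borel)"
proof -
  have [measurable]: "(\<lambda>t. max 0 (min T t)) \<in> borel \<rightarrow>\<^sub>M restrict_space borel {0..T}"
    using T_pos by (intro measurable_restrict_space2) auto
  show ?thesis by measurable
qed

text \<open>The flow equals \<mu> plus \<alpha> / (2 \<kappa>) times the impact of the deviation
  from \<mu>. The bound follows from \<open>impact_bound\<close>. Measurability is read off from the
  same identity, in which the term with \<open>E0\<close> is absorbed by the continuous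
  \<mu>.\<close>

lemma resulting_flow_minus_equilibrium:
  assumes eq: "equilibrium_flow T \<kappa> mbar \<theta> E0 \<alpha> \<mu>"
    and \<nu>: "(\<lambda>(a, t). \<nu> a t) \<in> borel_measurable (mbar \<Otimes>\<^sub>M restrict_space borel {0..T})"
    and D: "\<forall>a\<in>space mbar. \<forall>t\<in>{0..T}. \<bar>\<nu> a t - \<mu> t\<bar> \<le> D"
  shows "resulting_flow T \<kappa> mbar \<theta> E0 \<alpha> \<nu> \<in> borel_measurable (restrict_space borel {0..T})"
    and "t \<in> {0..T} \<Longrightarrow> \<bar>resulting_flow T \<kappa> mbar \<theta> E0 \<alpha> \<nu> t - \<mu> t\<bar>
           \<le> \<bar>\<alpha>\<bar> * (\<bar>T * (1 + T * B) / (2 * \<kappa>)\<bar> * D)"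
proof -
  \<comment> \<open>\<open>\<nu>\<close> and \<open>\<mu>\<close> may fail to be measurable outside \<open>{0..T}\<close>, hence the clamping of the time.\<close>
  define c where "c t = max 0 (min T t)" for t
  have c: "c t \<in> {0..T}" for t using T_pos by (simp add: c_def)
  have c_id: "c t = t" if "t \<in> {0..T}" for t using that by (simp add: c_def)
  define \<delta> where "\<delta> a t = \<nu> a (c t) - \<mu> (c t)" for a t
  have cont: "continuous_on {0..T} \<mu>"
    using eq by (simp add: equilibrium_flow_def)
  have \<mu>_meas[measurable]: "\<mu> \<in> borel_measurable (restrict_space borel {0..T})"
    by (rule borel_measurable_continuous_on_restrict[OF cont])
  obtain U where U: "\<bar>\<mu> t\<bar> \<le> U" if "t \<in> {0..T}" for t
    using continuous_on_Icc_bounded[OF cont] by blast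
  have \<nu>c: "(\<lambda>(a, t). \<nu> a (c t)) \<in> borel_measurable (mbar \<Otimes>\<^sub>M borel)"
    unfolding c_def by (rule measurable_clamp[OF \<nu>])
  have \<mu>c: "(\<lambda>(a, t). \<mu> (c t)) \<in> borel_measurable (mbar \<Otimes>\<^sub>M borel)"
    unfolding c_def by (rule measurable_clamp) measurable
  have \<delta>_meas: "(\<lambda>(a, t). \<delta> a t) \<in> borel_measurable (mbar \<Otimes>\<^sub>M borel)"
    using borel_measurable_diff[OF \<nu>c \<mu>c] by (simp add: \<delta>_def case_prod_beta)
  have \<delta>_bound: "\<bar>\<delta> a t\<bar> \<le> D" if "a \<in> space mbar" for a t
    using D that c by (simp add: \<delta>_def)
  \<comment> \<open>This bound serves integrability only; the final estimate uses the bound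
    \<open>D\<close> on the deviation \<delta>.\<close>
  have \<nu>_bound: "\<bar>\<nu> a (c t)\<bar> \<le> D + U" if "a \<in> space mbar" for a t
    using bspec[OF bspec[OF D that] c, of t] U[OF c, of t] by linarith
  have flow: "resulting_flow T \<kappa> mbar \<theta> E0 \<alpha> \<nu> t = \<mu> t + \<alpha> / (2 * \<kappa>) * impact T mbar \<theta> \<delta> t"
    if t: "t \<in> {0..T}" for t
  proof -
    have "impact T mbar \<theta> \<delta> t = impact T mbar \<theta> (\<lambda>a s. \<nu> a (c s)) t - impact T mbar \<theta> (\<lambda>a s. \<mu> (c s)) t"
      unfolding \<delta>_def using \<nu>_bound U[OF c] by (intro impact_diff[OF \<nu>c _ \<mu>c _ t]) auto
    also have "impact T mbar \<theta> (\<lambda>a s. \<nu> a (c s)) t = impact T mbar \<theta> \<nu> t"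
      by (intro impact_cong t) (simp add: c_id)
    also have "impact T mbar \<theta> (\<lambda>a s. \<mu> (c s)) t = impact T mbar \<theta> (\<lambda>_. \<mu>) t"
      by (intro impact_cong t) (simp add: c_id)
    finally show ?thesis
      using equilibrium_flow_impact[OF eq t] by (simp add: resulting_flow_impact right_diff_distrib)
  qed
  have [measurable]: "impact T mbar \<theta> \<delta> \<in> borel_measurable (restrict_space borel {0..T})"
    using measurable_impact[OF \<delta>_meas] by (rule measurable_restrict_space1)
  have "(\<lambda>t. \<mu> t + \<alpha> / (2 * \<kappa>) * impact T mbar \<theta> \<delta> t) \<in> borel_measurable (restrict_space borel {0..T})"
    by measurable
  \<comment> \<open>The two functions are known to agree on [0,T] only, which is the whole space of
    the restricted measure.\<close>
  then show "resulting_flow T \<kappa> mbar \<theta> E0 \<alpha> \<nu> \<in> borel_measurable (restrict_space borel {0..T})"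
    by (rule measurable_cong[THEN iffD1, rotated]) (simp add: flow space_restrict_space)
  show "\<bar>resulting_flow T \<kappa> mbar \<theta> E0 \<alpha> \<nu> t - \<mu> t\<bar>
      \<le> \<bar>\<alpha>\<bar> * (\<bar>T * (1 + T * B) / (2 * \<kappa>)\<bar> * D)" if t: "t \<in> {0..T}"
  proof -
    have "\<bar>impact T mbar \<theta> \<delta> t\<bar> \<le> T * (1 + T * B) * D"
      using \<delta>_bound by (intro impact_bound[OF \<delta>_meas _ t]) auto
    then have "\<bar>\<alpha> / (2 * \<kappa>)\<bar> * \<bar>impact T mbar \<theta> \<delta> t\<bar> \<le> \<bar>\<alpha> / (2 * \<kappa>)\<bar> * (T * (1 + T * B) * D)"
      by (intro mult_left_mono) auto
    then show ?thesis
      using T_pos B_nonneg by (simp add: flow[OF t] abs_mult mult_ac)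
  qed
qed

section \<open>The error recursion of the learning procedure\<close>

text \<open>A single sequence \<open>r\<close> serves all agents although their weights differ: each
  contraction factor is replaced by the worst one that the common lower bound on the weights
  permits. The limit 2 \<epsilon> is the fixed point of r \<mapsto> r/2 + \<epsilon>.\<close>

lemma learning_error_bound:
  assumes eq: "equilibrium_flow T \<kappa> mbar \<theta> E0 \<alpha> \<mu>"
    and learn: "learning_procedure T \<kappa> mbar \<theta> E0 \<alpha> \<epsilon> w err est"
    and small: "\<bar>\<alpha>\<bar> * \<bar>T * (1 + T * B) / (2 * \<kappa>)\<bar> \<le> 1 / 2"
    and C: "C > 0"
    and w: "\<And>a n. a \<in> space mbar \<Longrightarrow> n \<ge> 1 \<Longrightarrow> 1 / (C * real n) \<le> w a n"
  obtains r where "r \<longlonglongrightarrow> 2 * \<epsilon>"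
    and "\<And>a n t. a \<in> space mbar \<Longrightarrow> t \<in> {0..T} \<Longrightarrow> \<bar>est a n t - \<mu> t\<bar> \<le> r n"
proof -
  obtain a0 where a0: "a0 \<in> space mbar" using not_empty by auto
  note learn' = learn[unfolded learning_procedure_def]
  have err: "\<bar>err a n t\<bar> \<le> \<epsilon>" if "a \<in> space mbar" "n \<ge> 1" "t \<in> {0..T}" for a n t
  proof -
    have "sup_norm T (err a n) \<le> ereal \<epsilon>" using learn' that by blast
    then show ?thesis using that(3) unfolding sup_norm_def SUP_le_iff by simp
  qed
  have "0 \<le> \<epsilon>" using err[of a0 1 0] a0 T_pos by auto
  have w01: "0 < w a n" "w a n < 1" if "a \<in> space mbar" "n \<ge> 1" for a n
    using learn' that by blast+
  have step: "est a (Suc n) t = (1 - w a (Suc n)) * est a n t + w a (Suc n) *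
        (resulting_flow T \<kappa> mbar \<theta> E0 \<alpha> (\<lambda>b. est b n) t + err a (Suc n) t)"
    if "a \<in> space mbar" "t \<in> {0..T}" for a n t
    using learn' that by blast
  have [measurable]: "(\<lambda>a. w a (Suc n)) \<in> borel_measurable mbar"
    "(\<lambda>(a, t). err a (Suc n) t) \<in> borel_measurable (mbar \<Otimes>\<^sub>M restrict_space borel {0..T})" for n
    using learn' by simp_all
  have cont: "continuous_on {0..T} \<mu>"
    using eq by (simp add: equilibrium_flow_def)
  obtain U where U: "\<bar>\<mu> t\<bar> \<le> U" if "t \<in> {0..T}" for t
    using continuous_on_Icc_bounded[OF cont] by blast
  obtain V where V: "\<bar>est a 0 t\<bar> \<le> V" if "a \<in> space mbar" "t \<in> {0..T}" for a t
  proof -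
    have "(SUP a\<in>space mbar. sup_norm T (est a 0)) < \<infinity>" using learn' by blast
    then obtain m :: nat where "(SUP a\<in>space mbar. sup_norm T (est a 0)) < ereal m"
      using less_PInf_Ex_of_nat[of "SUP a\<in>space mbar. sup_norm T (est a 0)"] by auto
    then have V: "(SUP a\<in>space mbar. sup_norm T (est a 0)) \<le> ereal m" by (rule less_imp_le)
    show thesis
      using V unfolding sup_norm_def SUP_le_iff by (intro that[of "real m"]) simp
  qed
  define P where "P n = (\<Prod>i=1..n. 1 - 1 / (2 * C * real i))" for n
  \<comment> \<open>This bounds the initial distance to \<mu>, where \<open>P 0\<close> is the empty
    product 1.\<close>
  define D where "D = U + V"
  have D: "0 \<le> D" using U[of 0] V[of a0 0] a0 T_pos by (simp add: D_def)
  \<comment> \<open>A weight of some agent lies between 1 / (C i) and 1, which forces C i \<ge> 1.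
    Hence the factors of \<open>P\<close> are nonnegative.\<close>
  have factor: "1 / (2 * C * real i) \<le> 1" if "i \<ge> 1" for i
  proof -
    have "0 < C * real i" using C that by simp
    moreover have "1 / (C * real i) \<le> 1"
      by (rule order_trans[OF w[OF a0 that] less_imp_le[OF w01(2)[OF a0 that]]])
    ultimately have "1 \<le> C * real i" by (simp only: divide_le_eq_1_pos)
    then show ?thesis using \<open>0 < C * real i\<close> by (simp add: divide_le_eq_1 mult.assoc)
  qed
  have P: "0 \<le> P n" for n
    unfolding P_def using factor by (intro prod_nonneg) auto
  have "P \<longlonglongrightarrow> 0"
    unfolding P_def using C factor by (intro prod_one_minus_harmonic_tendsto_0) auto
  then have lim: "(\<lambda>n. 2 * \<epsilon> + D * P n) \<longlonglongrightarrow> 2 * \<epsilon>"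
    by (auto intro!: tendsto_eq_intros)
  \<comment> \<open>Measurability is carried through the induction because the bound on the flow of
    a round requires jointly measurable estimates in that round.\<close>
  have "(\<lambda>(a, t). est a n t) \<in> borel_measurable (mbar \<Otimes>\<^sub>M restrict_space borel {0..T}) \<and>
      (\<forall>a\<in>space mbar. \<forall>t\<in>{0..T}. \<bar>est a n t - \<mu> t\<bar> \<le> 2 * \<epsilon> + D * P n)" for n
  proof (induction n)
    case 0
    have "(\<lambda>(a, t). est a 0 t) \<in> borel_measurable (mbar \<Otimes>\<^sub>M restrict_space borel {0..T})"
      using learn' by blast
    moreover have "\<bar>est a 0 t - \<mu> t\<bar> \<le> 2 * \<epsilon> + D * P 0" if "a \<in> space mbar" "t \<in> {0..T}" for a t
      using U[OF that(2)] V[OF that] \<open>0 \<le> \<epsilon>\<close> by (simp add: P_def D_def)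
    ultimately show ?case by blast
  next
    case (Suc n)
    let ?r = "2 * \<epsilon> + D * P n" and ?m = "resulting_flow T \<kappa> mbar \<theta> E0 \<alpha> (\<lambda>b. est b n)"
    have meas[measurable]: "(\<lambda>(a, t). est a n t) \<in> borel_measurable (mbar \<Otimes>\<^sub>M restrict_space borel {0..T})"
      and r: "\<forall>a\<in>space mbar. \<forall>t\<in>{0..T}. \<bar>est a n t - \<mu> t\<bar> \<le> ?r"
      using Suc.IH by auto
    note flow[measurable] = resulting_flow_minus_equilibrium(1)[OF eq meas r]
    have "(\<lambda>(a, t). (1 - w a (Suc n)) * est a n t + w a (Suc n) * (?m t + err a (Suc n) t))
        \<in> borel_measurable (mbar \<Otimes>\<^sub>M restrict_space borel {0..T})"
      by measurable
    then have "(\<lambda>(a, t). est a (Suc n) t) \<in> borel_measurable (mbar \<Otimes>\<^sub>M restrict_space borel {0..T})"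
      by (rule measurable_cong[THEN iffD1, rotated])
        (auto simp: step space_pair_measure space_restrict_space)
    moreover have "\<bar>est a (Suc n) t - \<mu> t\<bar> \<le> 2 * \<epsilon> + D * P (Suc n)"
      if a: "a \<in> space mbar" and t: "t \<in> {0..T}" for a t
    proof -
      define v where "v = w a (Suc n)"
      have v: "0 < v" "v < 1" "1 / (C * real (Suc n)) \<le> v"
        using w01[OF a, of "Suc n"] w[OF a, of "Suc n"] by (auto simp: v_def)
      have "\<bar>?m t - \<mu> t\<bar> \<le> \<bar>\<alpha>\<bar> * (\<bar>T * (1 + T * B) / (2 * \<kappa>)\<bar> * ?r)"
        by (rule resulting_flow_minus_equilibrium(2)[OF eq meas r t])
      also have "\<dots> \<le> 1 / 2 * ?r"
        using mult_right_mono[OF small, of ?r] D P[of n] \<open>0 \<le> \<epsilon>\<close> by (simp add: mult_ac)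
      finally have "\<bar>?m t - \<mu> t + err a (Suc n) t\<bar> \<le> 1 / 2 * ?r + \<epsilon>"
        using err[OF a _ t, of "Suc n"] by linarith
      then have "v * \<bar>?m t - \<mu> t + err a (Suc n) t\<bar> \<le> v * (1 / 2 * ?r + \<epsilon>)"
        using v(1) by (intro mult_left_mono) auto
      moreover have "(1 - v) * \<bar>est a n t - \<mu> t\<bar> \<le> (1 - v) * ?r"
        using bspec[OF bspec[OF r a] t] v(2) by (intro mult_left_mono) auto
      \<comment> \<open>The two weights sum to 1, so \<mu> can be subtracted inside both terms of
        the update.\<close>
      moreover have "est a (Suc n) t - \<mu> t =
          (1 - v) * (est a n t - \<mu> t) + v * (?m t - \<mu> t + err a (Suc n) t)"
        using step[OF a t, of n] by (simp add: v_def algebra_simps)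
      then have "\<bar>est a (Suc n) t - \<mu> t\<bar> \<le>
          (1 - v) * \<bar>est a n t - \<mu> t\<bar> + v * \<bar>?m t - \<mu> t + err a (Suc n) t\<bar>"
        using v abs_triangle_ineq[of "(1 - v) * (est a n t - \<mu> t)"
            "v * (?m t - \<mu> t + err a (Suc n) t)"] by (simp add: abs_mult)
      ultimately have "\<bar>est a (Suc n) t - \<mu> t\<bar> \<le> (1 - v) * ?r + v * (1 / 2 * ?r + \<epsilon>)"
        by linarith
      \<comment> \<open>With r for \<open>?r\<close>, the left side is r - (v/2) (r - 2 \<epsilon>),
        and r - 2 \<epsilon> is \<open>D * P n\<close>.\<close>
      also have "\<dots> = 2 * \<epsilon> + D * P n * (1 - v / 2)"
        by (simp add: field_simps)
      \<comment> \<open>The weight of the individual agent is exchanged for the common lower bound;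
        this is where the estimate becomes uniform in the agent.\<close>
      also have "\<dots> \<le> 2 * \<epsilon> + D * P n * (1 - 1 / (2 * C * real (Suc n)))"
      proof -
        have "1 / (2 * C * real (Suc n)) = 1 / (C * real (Suc n)) / 2" by simp
        also have "\<dots> \<le> v / 2" using v(3) by (rule divide_right_mono) simp
        finally show ?thesis
          using D P[of n] by (intro add_left_mono mult_left_mono diff_left_mono mult_nonneg_nonneg)
      qed
      finally show ?thesis by (simp add: P_def mult_ac)
    qed
    ultimately show ?case by blast
  qed
  then show thesis using that[OF lim] by blast
qed

end

section \<open>Choice of the constants and passage to the limit\<close>

theorem proposition4p2:
  fixes T \<kappa> \<alpha>0 C :: real
    and M mbar :: "'a measure" and m0 :: "('a \<times> real) measure" and k :: "'a \<Rightarrow> real measure"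
    and \<phi> A \<theta> E0 :: "'a \<Rightarrow> real"
  assumes "T > 0" and "\<kappa> > 0"
    and "disintegrates M m0 mbar k"
    and "\<And>a. E0 a = (LINT q|k a. q)"
    and "A \<in> borel_measurable M"
    and "\<And>a. a \<in> space M \<Longrightarrow> \<phi> a \<ge> 0"
    and "\<And>a. a \<in> space M \<Longrightarrow> A a = sqrt (\<phi> a * \<kappa>)"
    and "bounded (A ` space M)"
    and "\<And>a. \<theta> a = A a / \<kappa>"
    and "\<alpha>0 > 0"
    and "\<And>\<alpha>. \<bar>\<alpha>\<bar> \<le> \<alpha>0 \<Longrightarrow>
           \<exists>\<mu>. equilibrium_flow T \<kappa> mbar \<theta> E0 \<alpha> \<mu> \<and>
             (\<forall>\<nu>. equilibrium_flow T \<kappa> mbar \<theta> E0 \<alpha> \<nu> \<longrightarrow> (\<forall>t\<in>{0..T}. \<nu> t = \<mu> t))"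
    and "C > 0"
  shows "\<exists>\<alpha>1>0. \<alpha>1 \<le> \<alpha>0 \<and>
    (\<exists>C'. \<forall>\<alpha> \<mu> \<epsilon> w err est.
       \<bar>\<alpha>\<bar> \<le> \<alpha>1 \<longrightarrow>
       equilibrium_flow T \<kappa> mbar \<theta> E0 \<alpha> \<mu> \<longrightarrow>
       learning_procedure T \<kappa> mbar \<theta> E0 \<alpha> \<epsilon> w err est \<longrightarrow>
       (\<forall>a\<in>space M. \<forall>n\<ge>1. 1 / (C * real n) \<le> w a n \<and> w a n \<le> C / real n) \<longrightarrow>
       limsup (\<lambda>n. SUP a\<in>space M. sup_norm T (\<lambda>t. est a n t - \<mu> t)) \<le> ereal (C' * \<epsilon>))"
proof -
  have m0: "prob_space m0" "sets m0 = sets (M \<Otimes>\<^sub>M borel)" and mbar: "mbar = distr m0 M fst"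
    using assms(3) by (auto simp: disintegrates_def)
  have "fst \<in> m0 \<rightarrow>\<^sub>M M"
    using measurable_fst measurable_cong_sets[OF m0(2) refl] by blast
  then have "prob_space mbar" unfolding mbar by (rule prob_space.prob_space_distr[OF m0(1)])
  have [simp]: "space mbar = space M" and sets: "sets mbar = sets M"
    by (simp_all add: mbar)
  obtain R where R: "\<And>a. a \<in> space M \<Longrightarrow> \<bar>A a\<bar> \<le> R"
    using assms(8) by (auto simp: bounded_iff)
  have "\<theta> = (\<lambda>a. A a / \<kappa>)" using assms(9) by auto
  moreover have "A \<in> borel_measurable mbar"
    using assms(5) measurable_cong_sets[OF sets refl] by blast
  ultimately have "\<theta> \<in> borel_measurable mbar" by simp
  then interpret bounded_agents mbar T "R / \<kappa>" \<theta>
    using assms(1,2,6,7,9) R \<open>prob_space mbar\<close>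
    by (auto simp: bounded_agents_def bounded_agents_axioms_def divide_right_mono abs_le_iff)
  define L where "L = \<bar>T * (1 + T * (R / \<kappa>)) / (2 * \<kappa>)\<bar>"
  \<comment> \<open>The second entry gives \<bar>\<alpha>\<bar> L \<le> L / (2 (L + 1)) \<le> 1/2;
    the summand 1 keeps the denominator positive when only L \<ge> 0 is known.\<close>
  define \<alpha>1 where "\<alpha>1 = min \<alpha>0 (1 / (2 * (L + 1)))"
  have L: "0 \<le> L" by (simp add: L_def)
  \<comment> \<open>The witness for \<open>C'\<close> is 2, so it depends on none of the
    data.\<close>
  have "limsup (\<lambda>n. SUP a\<in>space M. sup_norm T (\<lambda>t. est a n t - \<mu> t)) \<le> ereal (2 * \<epsilon>)"
    if \<alpha>: "\<bar>\<alpha>\<bar> \<le> \<alpha>1" and eq: "equilibrium_flow T \<kappa> mbar \<theta> E0 \<alpha> \<mu>"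
      and learn: "learning_procedure T \<kappa> mbar \<theta> E0 \<alpha> \<epsilon> w err est"
      and w: "\<forall>a\<in>space M. \<forall>n\<ge>1. 1 / (C * real n) \<le> w a n \<and> w a n \<le> C / real n"
    for \<alpha> \<mu> \<epsilon> w err est
  proof -
    have "\<bar>\<alpha>\<bar> * L \<le> 1 / (2 * (L + 1)) * L"
      using \<alpha> L by (intro mult_right_mono) (auto simp: \<alpha>1_def)
    also have "\<dots> \<le> 1 / 2" using L by (simp add: field_simps)
    finally have small: "\<bar>\<alpha>\<bar> * L \<le> 1 / 2" .
    obtain r where r: "r \<longlonglongrightarrow> 2 * \<epsilon>"
      and bound: "\<And>a n t. a \<in> space M \<Longrightarrow> t \<in> {0..T} \<Longrightarrow> \<bar>est a n t - \<mu> t\<bar> \<le> r n"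
      using learning_error_bound[OF eq learn small[unfolded L_def] assms(12)] w by auto
    have lim: "limsup (\<lambda>n. ereal (r n)) = ereal (2 * \<epsilon>)"
      using r by (intro lim_imp_Limsup) auto
    \<comment> \<open>For each n the number \<open>r n\<close> bounds the error for all agents and
      times at once, hence also both suprema.\<close>
    have "limsup (\<lambda>n. SUP a\<in>space M. sup_norm T (\<lambda>t. est a n t - \<mu> t))
        \<le> limsup (\<lambda>n. ereal (r n))"
      unfolding sup_norm_def using bound by (intro Limsup_mono always_eventually allI SUP_least) simp
    then show ?thesis unfolding lim .
  qed
  moreover have "0 < \<alpha>1" "\<alpha>1 \<le> \<alpha>0"
    using assms(10) L by (auto simp: \<alpha>1_def)
  ultimately show ?thesis by blast
qed

end
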